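(* Let $\Sigma$ be a compact surface with an Oxtoby-Ulam probability measure $\mu$, and let $F\colon\Sigma\to\Sigma$ be a measurable pseudo-Anosov map. Then $F$ is topologically transitive: for all non-empty open subsets $U,V\subset\Sigma$ there is some $n>0$ with $F^n(U)\cap V\neq\emptyset$.
   Context: Setting. $\Sigma$ is a compact surface and $\mu$ is an Oxtoby-Ulam (OU) measure on $\Sigma$: a Borel measure which is non-atomic, positive on non-empty open sets, and satisfies $\mu(\partial\Sigma)=0$; moreover $\mu(\Sigma)=1$. Measured turbulations. An immersed line is a continuous injective image of $\mathbb{R}$ in $\Sigma$ (with the topology of $\mathbb{R}$). A measured turbulation $(\mathcal{T},\nu)$ on $\Sigma$ is a partition of a full $\mu$-measure Borel subset of $\Sigma$ into immersed lines called streamlines, together with, on each streamline $\ell$, an OU measure $\nu_\ell$ (the stream measure: Borel, non-atomic, positive on non-empty open subsets of $\ell$) which is finite on closed arcs of $\ell$. It has dense streamlines if every streamline is dense in $\Sigma$. For distinct points $x,y$ of a streamline $\ell$, $[x,y]$ denotes the closed arc of $\ell$ with endpoints $x,y$; closed, half-open and open such arcs are called stream arcs, and the measure of a stream arc is its stream measure. $(\mathcal{T},\nu)$ is tame if, for a metric $d$ compatible with the topology of $\Sigma$ (the choice is irrelevant), for every $\epsilon>0$ there is $\delta>0$ such that every stream arc $[x,y]$ with $\nu([x,y])<\delta$ has $d(x,y)<\epsilon$. Two measured turbulations are transverse if there is a full $\mu$-measure subset of $\Sigma$ every point $x$ of which lies in streamlines $\ell,\ell'$ of the two turbulations which intersect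 (topologically) transversely at $x$. Tartans. Let $(\mathcal{T}^s,\nu^s)$, $(\mathcal{T}^u,\nu^u)$ be a transverse pair of measured turbulations, called stable and unstable. A tartan $R=(R^s,R^u)$ consists of Borel subsets $R^s,R^u$ of $\Sigma$ which are disjoint unions of stable and unstable stream arcs respectively (called the stable and unstable fibers of $R$), such that: (a) every arc of $R^s$ intersects every arc of $R^u$ exactly once, either transversely or at an endpoint of one or both arcs; (b) the arcs can be oriented so that every arc of $R^s$ (respectively $R^u$) crosses the arcs of $R^u$ (respectively $R^s$) in the same order; (c) the measures of the arcs of $R^s$ and $R^u$ are bounded above; (d) some open topological disk in $\Sigma$ contains $R^s\cup R^u$. Write $R^\pitchfork=R^s\cap R^u$; $R$ is a positive measure tartan if $\mu(R^\pitchfork)>0$. For $x\in R^\pitchfork$, $\mathfrak{s}(x)$ and $\mathfrak{u}(x)$ are the stable and unstable fibers of $R$ containing $x$; for a stable fiber $\mathfrak{s}$ and unstable fiber $\mathfrak{u}$, $\mathfrak{s}\pitchfork\mathfrak{u}=\mathfrak{u}\pitchfork\mathfrak{s}$ is their unique intersection point, $E^{\mathfrak{s}}=\mathfrak{s}\cap R^\pitchfork$, $E^{\mathfrak{u}}=\mathfrak{u}\cap R^\pitchfork$, and $\nu_{\mathfrak{s}},\nu_{\mathfrak{u}}$ are the restrictions of the stream measures to $E^{\mathfrak{s}},E^{\mathfrak{u}}$. $R$ is compatible if, for all stable and unstable fibers $\mathfrak{s},\mathfrak{u}$ of $R$, the bijection $\psi^{\mathfrak{s},\mathfrak{u}}\colon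 E^{\mathfrak{s}}\times E^{\mathfrak{u}}\to R^\pitchfork$, $(x,y)\mapsto\mathfrak{u}(x)\pitchfork\mathfrak{s}(y)$, is bi-measurable and $\psi^{\mathfrak{s},\mathfrak{u}}_*(\nu_{\mathfrak{s}}\times\nu_{\mathfrak{u}})=\mu|_{R^\pitchfork}$. Fullness. The transverse pair is full if (a) there is a countable collection $R_i$ of positive measure compatible tartans with $\mu(\bigcup_i R_i^\pitchfork)=1$; and (b) for every non-empty open $U\subset\Sigma$ there is a positive measure compatible tartan $R$ with $R^s\cup R^u\subset U$. Measurable pseudo-Anosov maps. A pair $(\mathcal{T}^s,\nu^s),(\mathcal{T}^u,\nu^u)$ are measurable pseudo-Anosov turbulations if they are transverse, tame, full, and have dense streamlines. For a $\mu$-preserving homeomorphism $F\colon\Sigma\to\Sigma$, $F(\mathcal{T},\nu)$ is the measured turbulation with streamlines $F(\ell)$, $\ell\in\mathcal{T}$, and measure $F_*(\nu_\ell)$ on $F(\ell)$. $F$ is measurable pseudo-Anosov if there are measurable pseudo-Anosov turbulations $(\mathcal{T}^s,\nu^s),(\mathcal{T}^u,\nu^u)$ and a number $\lambda>1$ (the dilatation) such that $F(\mathcal{T}^s,\nu^s)=(\mathcal{T}^s,\lambda\nu^s)$ and $F(\mathcal{T}^u,\nu^u)=(\mathcal{T}^u,\lambda^{-1}\nu^u)$. (So $F$ contracts stable stream measure and expands unstable stream measure by the factor $\lambda$.) *)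

theory Defs
  imports "HOL-Probability.Probability"
begin

section \<open>Compact surfaces and Oxtoby-Ulam measures\<close>

definition half_plane :: "(real \<times> real) set" where
  "half_plane = {p. 0 \<le> snd p}"

text \<open>Surfaces may have boundary. Connectedness is not required here.\<close>

definition compact_surface :: "'a topology \<Rightarrow> bool" where
  "compact_surface X \<longleftrightarrow>
     compact_space X \<and> Hausdorff_space X \<and> second_countable X \<and>
     (\<forall>x\<in>topspace X. \<exists>U V. openin X U \<and> x \<in> U \<and> openin (top_of_set half_plane) V \<and>
        subtopology X U homeomorphic_space top_of_set V)"

definition surface_boundary :: "'a topology \<Rightarrow> 'a set" where
  "surface_boundary X = topspace X -
     {x. \<exists>U (V :: (real \<times> real) set). openin X U \<and> x \<in> U \<and> open V \<and>
           subtopology X U homeomorphic_space top_of_set V}"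

definition borel_of :: "'a topology \<Rightarrow> 'a measure" where
  "borel_of X = sigma (topspace X) {U. openin X U}"

definition nonatomic :: "'a measure \<Rightarrow> bool" where
  "nonatomic M \<longleftrightarrow>
     \<not> (\<exists>A\<in>sets M. emeasure M A > 0 \<and>
          (\<forall>B\<in>sets M. B \<subseteq> A \<longrightarrow> emeasure M B = 0 \<or> emeasure M (A - B) = 0))"

definition OU_measure :: "'a topology \<Rightarrow> 'a measure \<Rightarrow> bool" where
  "OU_measure X M \<longleftrightarrow>
     space M = topspace X \<and> sets M = sets (borel_of X) \<and> nonatomic M \<and>
     (\<forall>U. openin X U \<and> U \<noteq> {} \<longrightarrow> emeasure M U > 0)"

definition OU_surface_measure :: "'a topology \<Rightarrow> 'a measure \<Rightarrow> bool" where
  "OU_surface_measure X \<mu> \<longleftrightarrow> OU_measure X \<mu> \<and> surface_boundary X \<in> null_sets \<mu>"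


section \<open>Measured turbulations\<close>

text \<open>
  An immersed line carries the topology of the real line, which is in general finer than the
  subspace topology and is not determined by the underlying point set (a figure eight is an
  injective continuous image of the line in several inequivalent ways). It is therefore
  represented by a topology \<open>L\<close>, with underlying set \<open>topspace L\<close>.
\<close>

definition immersed_line :: "'a topology \<Rightarrow> 'a topology \<Rightarrow> bool" where
  "immersed_line X L \<longleftrightarrow>
     (\<exists>\<phi>. homeomorphic_map euclideanreal L \<phi> \<and> continuous_map euclideanreal X \<phi>)"

definition closed_arc :: "'a topology \<Rightarrow> 'a \<Rightarrow> 'a \<Rightarrow> 'a set" where
  "closed_arc L x y =
     {z. \<exists>\<phi> a b t. homeomorphic_map euclideanreal L \<phi> \<and> \<phi> a = x \<and> \<phi> b = y \<and>
           t \<in> closed_segment a b \<and> \<phi> t = z}"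

definition arc_between :: "'a topology \<Rightarrow> 'a \<Rightarrow> 'a \<Rightarrow> 'a set \<Rightarrow> bool" where
  "arc_between L x y A \<longleftrightarrow>
     x \<in> topspace L \<and> y \<in> topspace L \<and> x \<noteq> y \<and>
     A \<in> {closed_arc L x y, closed_arc L x y - {x}, closed_arc L x y - {y},
          closed_arc L x y - {x, y}}"

definition stream_arc :: "'a topology \<Rightarrow> 'a set \<Rightarrow> bool" where
  "stream_arc L A \<longleftrightarrow> (\<exists>x y. arc_between L x y A)"

text \<open>An endpoint of a stream arc need not belong to the arc.\<close>

definition arc_endpoint :: "'a topology \<Rightarrow> 'a set \<Rightarrow> 'a \<Rightarrow> bool" where
  "arc_endpoint L A x \<longleftrightarrow> (\<exists>y. arc_between L x y A)"

text \<open>The set of all streamlines, each paired with its stream measure.\<close>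

type_synonym 'a turbulation = "('a topology \<times> 'a measure) set"

definition measured_turbulation :: "'a topology \<Rightarrow> 'a measure \<Rightarrow> 'a turbulation \<Rightarrow> bool" where
  "measured_turbulation X \<mu> T \<longleftrightarrow>
     (\<forall>(L, \<nu>)\<in>T. immersed_line X L \<and> OU_measure L \<nu> \<and>
        (\<forall>x\<in>topspace L. \<forall>y\<in>topspace L. x \<noteq> y \<longrightarrow> emeasure \<nu> (closed_arc L x y) < \<infinity>)) \<and>
     (\<forall>p\<in>T. \<forall>q\<in>T. p \<noteq> q \<longrightarrow> topspace (fst p) \<inter> topspace (fst q) = {}) \<and>
     (\<Union>(L, \<nu>)\<in>T. topspace L) \<in> sets \<mu> \<and>
     emeasure \<mu> (\<Union>(L, \<nu>)\<in>T. topspace L) = emeasure \<mu> (topspace X)"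

definition dense_streamlines :: "'a topology \<Rightarrow> 'a turbulation \<Rightarrow> bool" where
  "dense_streamlines X T \<longleftrightarrow> (\<forall>(L, \<nu>)\<in>T. X closure_of (topspace L) = topspace X)"

text \<open>On a compact space the choice of the compatible metric \<open>d\<close> is irrelevant.\<close>

definition tame :: "'a topology \<Rightarrow> 'a turbulation \<Rightarrow> bool" where
  "tame X T \<longleftrightarrow>
     (\<exists>d. Metric_space (topspace X) d \<and> Metric_space.mtopology (topspace X) d = X \<and>
        (\<forall>\<epsilon>>0. \<exists>\<delta>>0. \<forall>(L, \<nu>)\<in>T. \<forall>x\<in>topspace L. \<forall>y\<in>topspace L.
           x \<noteq> y \<and> emeasure \<nu> (closed_arc L x y) < ennreal \<delta> \<longrightarrow> d x y < \<epsilon>))"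

text \<open>
  Topological transversality: in suitable local coordinates, arcs of the two lines around \<open>x\<close>
  become the coordinate axes. The coordinate neighbourhood \<open>U\<close> may contain further pieces of
  either line.
\<close>

definition transverse_at :: "'a topology \<Rightarrow> 'a topology \<Rightarrow> 'a topology \<Rightarrow> 'a \<Rightarrow> bool" where
  "transverse_at X L L' x \<longleftrightarrow>
     (\<exists>U (h :: 'a \<Rightarrow> real \<times> real) A A'.
        openin X U \<and> x \<in> U \<and> homeomorphic_map (subtopology X U) euclidean h \<and> h x = (0, 0) \<and>
        stream_arc L A \<and> A \<subseteq> U \<and> h ` A = UNIV \<times> {0} \<and>
        stream_arc L' A' \<and> A' \<subseteq> U \<and> h ` A' = {0} \<times> UNIV)"

definition transverse_pair ::
    "'a topology \<Rightarrow> 'a measure \<Rightarrow> 'a turbulation \<Rightarrow> 'a turbulation \<Rightarrow> bool" where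
  "transverse_pair X \<mu> Ts Tu \<longleftrightarrow>
     (AE x in \<mu>. \<exists>(L, \<nu>)\<in>Ts. \<exists>(L', \<nu>')\<in>Tu.
        x \<in> topspace L \<and> x \<in> topspace L' \<and> transverse_at X L L' x)"

text \<open>The streamline containing a stream arc, together with its stream measure.\<close>

definition stream_of :: "'a turbulation \<Rightarrow> 'a set \<Rightarrow> 'a topology \<times> 'a measure" where
  "stream_of T A = (THE p. p \<in> T \<and> stream_arc (fst p) A)"

abbreviation line_of :: "'a turbulation \<Rightarrow> 'a set \<Rightarrow> 'a topology" where
  "line_of T A \<equiv> fst (stream_of T A)"

abbreviation stream_measure :: "'a turbulation \<Rightarrow> 'a set \<Rightarrow> 'a measure" where
  "stream_measure T A \<equiv> snd (stream_of T A)"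


section \<open>Tartans\<close>

text \<open>A pair consisting of the set of stable fibers and the set of unstable fibers.\<close>

type_synonym 'a tartan = "'a set set \<times> 'a set set"

definition tartan_points :: "'a tartan \<Rightarrow> 'a set" where
  "tartan_points R = \<Union>(fst R) \<inter> \<Union>(snd R)"

definition fiber_family :: "'a topology \<Rightarrow> 'a turbulation \<Rightarrow> 'a set set \<Rightarrow> bool" where
  "fiber_family X T S \<longleftrightarrow>
     (\<forall>A\<in>S. \<exists>(L, \<nu>)\<in>T. stream_arc L A) \<and> disjoint S \<and> \<Union>S \<in> sets (borel_of X)"

text \<open>Along the parametrization \<open>\<phi>\<close>, the arc \<open>A\<close> meets \<open>B\<close> before \<open>B'\<close>.\<close>

definition meets_before :: "(real \<Rightarrow> 'a) \<Rightarrow> 'a set \<Rightarrow> 'a set \<Rightarrow> 'a set \<Rightarrow> bool" where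
  "meets_before \<phi> A B B' \<longleftrightarrow> (\<exists>t t'. t < t' \<and> \<phi> t \<in> A \<inter> B \<and> \<phi> t' \<in> A \<inter> B')"

text \<open>
  An orientation of the arc \<open>A\<close> is given by a parametrization \<open>orient A\<close> of its streamline;
  distinct arcs of one streamline may be oriented independently.
\<close>

definition same_crossing_order :: "'a turbulation \<Rightarrow> 'a set set \<Rightarrow> 'a set set \<Rightarrow> bool" where
  "same_crossing_order T S S' \<longleftrightarrow>
     (\<exists>orient. (\<forall>A\<in>S. homeomorphic_map euclideanreal (line_of T A) (orient A)) \<and>
        (\<forall>A\<in>S. \<forall>A'\<in>S. \<forall>B\<in>S'. \<forall>B'\<in>S'.
           meets_before (orient A) A B B' \<longleftrightarrow> meets_before (orient A') A' B B'))"

definition tartan ::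
    "'a topology \<Rightarrow> 'a turbulation \<Rightarrow> 'a turbulation \<Rightarrow> 'a tartan \<Rightarrow> bool" where
  "tartan X Ts Tu R \<longleftrightarrow>
     fiber_family X Ts (fst R) \<and> fiber_family X Tu (snd R) \<and>
     (\<forall>A\<in>fst R. \<forall>B\<in>snd R. \<exists>x. A \<inter> B = {x} \<and>
        (transverse_at X (line_of Ts A) (line_of Tu B) x \<or>
         arc_endpoint (line_of Ts A) A x \<or> arc_endpoint (line_of Tu B) B x)) \<and>
     same_crossing_order Ts (fst R) (snd R) \<and> same_crossing_order Tu (snd R) (fst R) \<and>
     (\<exists>K::real. (\<forall>A\<in>fst R. emeasure (stream_measure Ts A) A \<le> ennreal K) \<and>
                (\<forall>B\<in>snd R. emeasure (stream_measure Tu B) B \<le> ennreal K)) \<and>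
     (\<exists>D. openin X D \<and>
        subtopology X D homeomorphic_space top_of_set (ball (0 :: real \<times> real) 1) \<and>
        \<Union>(fst R) \<union> \<Union>(snd R) \<subseteq> D)"

definition positive_measure_tartan :: "'a measure \<Rightarrow> 'a tartan \<Rightarrow> bool" where
  "positive_measure_tartan \<mu> R \<longleftrightarrow> emeasure \<mu> (tartan_points R) > 0"

definition fiber_through :: "'a set set \<Rightarrow> 'a \<Rightarrow> 'a set" where
  "fiber_through S x = (THE A. A \<in> S \<and> x \<in> A)"

definition meet :: "'a set \<Rightarrow> 'a set \<Rightarrow> 'a" where
  "meet A B = (THE x. x \<in> A \<inter> B)"

definition tartan_map :: "'a tartan \<Rightarrow> 'a \<times> 'a \<Rightarrow> 'a" where
  "tartan_map R = (\<lambda>(x, y). meet (fiber_through (snd R) x) (fiber_through (fst R) y))"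

definition fiber_measure :: "'a turbulation \<Rightarrow> 'a tartan \<Rightarrow> 'a set \<Rightarrow> 'a measure" where
  "fiber_measure T R A = restrict_space (stream_measure T A) (A \<inter> tartan_points R)"

definition compatible_tartan ::
    "'a measure \<Rightarrow> 'a turbulation \<Rightarrow> 'a turbulation \<Rightarrow> 'a tartan \<Rightarrow> bool" where
  "compatible_tartan \<mu> Ts Tu R \<longleftrightarrow>
     (\<forall>A\<in>fst R. \<forall>B\<in>snd R.
        let P = fiber_measure Ts R A \<Otimes>\<^sub>M fiber_measure Tu R B;
            Q = restrict_space \<mu> (tartan_points R);
            E = (A \<inter> tartan_points R) \<times> (B \<inter> tartan_points R)
        in tartan_map R \<in> measurable P Q \<and>
           the_inv_into E (tartan_map R) \<in> measurable Q P \<and>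
           distr P Q (tartan_map R) = Q)"

definition full_pair ::
    "'a topology \<Rightarrow> 'a measure \<Rightarrow> 'a turbulation \<Rightarrow> 'a turbulation \<Rightarrow> bool" where
  "full_pair X \<mu> Ts Tu \<longleftrightarrow>
     (let good = (\<lambda>R. tartan X Ts Tu R \<and> positive_measure_tartan \<mu> R \<and>
                      compatible_tartan \<mu> Ts Tu R)
      in (\<exists>\<R>. countable \<R> \<and> (\<forall>R\<in>\<R>. good R) \<and> emeasure \<mu> (\<Union>R\<in>\<R>. tartan_points R) = 1) \<and>
         (\<forall>U. openin X U \<and> U \<noteq> {} \<longrightarrow>
            (\<exists>R. good R \<and> \<Union>(fst R) \<union> \<Union>(snd R) \<subseteq> U)))"


section \<open>Measurable pseudo-Anosov maps\<close>

definition mpA_turbulations ::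
    "'a topology \<Rightarrow> 'a measure \<Rightarrow> 'a turbulation \<Rightarrow> 'a turbulation \<Rightarrow> bool" where
  "mpA_turbulations X \<mu> Ts Tu \<longleftrightarrow>
     measured_turbulation X \<mu> Ts \<and> measured_turbulation X \<mu> Tu \<and>
     transverse_pair X \<mu> Ts Tu \<and> tame X Ts \<and> tame X Tu \<and> full_pair X \<mu> Ts Tu \<and>
     dense_streamlines X Ts \<and> dense_streamlines X Tu"

text \<open>
  The image of the immersed line \<open>L\<close> under a map injective on it, with the transported topology:
  the open sets are the images of the open sets of \<open>L\<close>.
\<close>

definition image_line :: "('a \<Rightarrow> 'a) \<Rightarrow> 'a topology \<Rightarrow> 'a topology" where
  "image_line F L = pullback_topology (F ` topspace L) (inv_into (topspace L) F) L"

lemma homeomorphic_map_image_line: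
  assumes "inj_on F (topspace L)"
  shows "homeomorphic_map L (image_line F L) F"
proof -
  let ?g = "inv_into (topspace L) F"
  have vimage: "?g -` V \<inter> F ` topspace L = F ` V" if "V \<subseteq> topspace L" for V
    using that assms by (auto simp: image_iff)
  have open_iff: "openin (image_line F L) W \<longleftrightarrow> (\<exists>V. openin L V \<and> W = F ` V)" for W
    unfolding image_line_def openin_pullback_topology using vimage openin_subset by metis
  have top: "topspace (image_line F L) = F ` topspace L"
    unfolding image_line_def topspace_pullback_topology using vimage by blast
  have "continuous_map L (image_line F L) F"
    unfolding continuous_map
  proof (intro conjI allI impI)
    fix W assume "openin (image_line F L) W"
    then obtain V where V: "openin L V" "W = F ` V"
      using open_iff by blast
    then have "{x \<in> topspace L. F x \<in> W} = V"
      using assms openin_subset[OF V(1)] by (auto simp: inj_on_def)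
    then show "openin L {x \<in> topspace L. F x \<in> W}"
      using V by simp
  qed (simp add: top)
  moreover have "open_map L (image_line F L) F"
    unfolding open_map_def using open_iff by blast
  ultimately show ?thesis
    using assms top by (auto simp: bijective_open_imp_homeomorphic_map)
qed

definition image_turbulation :: "('a \<Rightarrow> 'a) \<Rightarrow> 'a turbulation \<Rightarrow> 'a turbulation" where
  "image_turbulation F T = (\<lambda>(L, \<nu>). (image_line F L, distr \<nu> (borel_of (image_line F L)) F)) ` T"

definition scale_turbulation :: "real \<Rightarrow> 'a turbulation \<Rightarrow> 'a turbulation" where
  "scale_turbulation c T = (\<lambda>(L, \<nu>). (L, scale_measure (ennreal c) \<nu>)) ` T"

definition measurable_pseudo_Anosov :: "'a topology \<Rightarrow> 'a measure \<Rightarrow> ('a \<Rightarrow> 'a) \<Rightarrow> bool" where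
  "measurable_pseudo_Anosov X \<mu> F \<longleftrightarrow>
     homeomorphic_map X X F \<and> distr \<mu> \<mu> F = \<mu> \<and>
     (\<exists>Ts Tu. \<exists>k>1. mpA_turbulations X \<mu> Ts Tu \<and>
        image_turbulation F Ts = scale_turbulation k Ts \<and>
        image_turbulation F Tu = scale_turbulation (inverse k) Tu)"

end

theory Submission
  imports Defs
begin

text \<open>
  Transitivity follows from Poincare recurrence for the inverse map, together with the contraction
  of unstable arcs under that inverse. Let \<open>d\<close> be a metric witnessing that the unstable turbulation
  is tame, and let \<open>A\<close> be a \<open>d\<close>-ball whose concentric ball of twice the radius lies in \<open>U\<close>. Almost
  every point \<open>x\<close> of \<open>A\<close> lies on an unstable streamline and satisfies \<open>F\<^sup>-\<^sup>n x \<in> A\<close> for infinitely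
  many \<open>n\<close> (\<open>recurrence_open\<close>). Fix such an \<open>x\<close>. Its unstable streamline is dense, so it contains
  a point \<open>y\<close> of \<open>V\<close>. The arc from \<open>x\<close> to \<open>y\<close> has finite measure \<open>c\<close>, and its image under \<open>F\<^sup>-\<^sup>n\<close> is
  an unstable arc of measure \<open>k\<^sup>-\<^sup>n c\<close>, where \<open>k > 1\<close> is the dilatation (\<open>pull_back_arc_funpow\<close>), so by tameness the distance between
  \<open>F\<^sup>-\<^sup>n x\<close> and \<open>F\<^sup>-\<^sup>n y\<close> tends to \<open>0\<close>. At a large return time \<open>n\<close> of \<open>x\<close>, the point \<open>F\<^sup>-\<^sup>n y\<close>
  is therefore in \<open>U\<close>, that is, \<open>y \<in> F\<^sup>n(U) \<inter> V\<close>.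
\<close>

section \<open>Arcs of lines\<close>

text \<open>
  The definition of an arc takes the union over all parametrizations of the line; every single one
  already gives the whole arc. Indeed, for two parametrizations the image of a segment under the
  transition homeomorphism is connected, and so contains the segment between the images of the
  endpoints; exchanging the roles gives the other inclusion.
\<close>

lemma closed_arc_parametrization:
  assumes \<phi>: "homeomorphic_map euclideanreal L \<phi>"
  shows "closed_arc L (\<phi> a) (\<phi> b) = \<phi> ` closed_segment a b"
proof -
  have "\<theta> ` closed_segment a' b' \<subseteq> \<phi> ` closed_segment a b"
    if \<theta>: "homeomorphic_map euclideanreal L \<theta>" and ends: "\<theta> a' = \<phi> a" "\<theta> b' = \<phi> b" for \<theta> a' b'
  proof -
    obtain g where g: "homeomorphic_maps euclideanreal L \<theta> g"
      using \<theta> homeomorphic_map_maps by blast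
    have cont: "continuous_map euclideanreal euclideanreal (g \<circ> \<phi>)"
      using g homeomorphic_imp_continuous_map[OF \<phi>]
      by (meson continuous_map_compose homeomorphic_maps_def)
    have gends: "g (\<phi> a) = a'" "g (\<phi> b) = b'"
      using g ends by (auto simp: homeomorphic_maps_def simp flip: ends)
    have "connected ((g \<circ> \<phi>) ` closed_segment a b)"
      using cont by (intro connected_continuous_image)
        (auto simp: continuous_map_iff_continuous2 intro: continuous_on_subset)
    moreover have "a' \<in> (g \<circ> \<phi>) ` closed_segment a b" "b' \<in> (g \<circ> \<phi>) ` closed_segment a b"
      using gends by (force simp: image_iff)+
    ultimately have "closed_segment a' b' \<subseteq> (g \<circ> \<phi>) ` closed_segment a b"
      by (meson closed_segment_subset is_interval_connected_1 is_interval_convex_1)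
    moreover have "\<theta> (g (\<phi> t)) = \<phi> t" for t
      using g homeomorphic_imp_surjective_map[OF \<phi>] by (force simp: homeomorphic_maps_def)
    ultimately show ?thesis
      by fastforce
  qed
  then show ?thesis
    using \<phi> unfolding closed_arc_def by blast
qed

lemma closed_arc_homeomorphic_image:
  assumes \<phi>: "homeomorphic_map euclideanreal L \<phi>" and F: "homeomorphic_map L L' F"
    and "x \<in> topspace L" "y \<in> topspace L"
  shows "closed_arc L' (F x) (F y) = F ` closed_arc L x y"
proof -
  obtain a b where "x = \<phi> a" "y = \<phi> b"
    using assms homeomorphic_imp_surjective_map[OF \<phi>] by force
  then show ?thesis
    using closed_arc_parametrization[OF \<phi>, of a b]
      closed_arc_parametrization[OF homeomorphic_map_compose[OF \<phi> F], of a b]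
    by (simp add: image_comp)
qed

lemma space_borel_of [simp]: "space (borel_of X) = topspace X"
  by (simp add: borel_of_def space_measure_of_conv)

lemma openin_imp_sets_borel_of: "openin X U \<Longrightarrow> U \<in> sets (borel_of X)"
  by (auto simp: borel_of_def sets_measure_of_conv dest: openin_subset)

lemma closedin_imp_sets_borel_of:
  assumes "closedin X C"
  shows "C \<in> sets (borel_of X)"
proof -
  have "space (borel_of X) - (topspace X - C) \<in> sets (borel_of X)"
    using assms by (intro sets.compl_sets openin_imp_sets_borel_of) blast
  then show ?thesis
    using closedin_subset[OF assms] by (simp add: double_diff)
qed

lemma continuous_map_imp_measurable_borel_of:
  assumes "continuous_map X Y f"
  shows "f \<in> measurable (borel_of X) (borel_of Y)"
  unfolding borel_of_def[of Y]
proof (rule measurable_measure_of)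
  show "f -` U \<inter> space (borel_of X) \<in> sets (borel_of X)" if "U \<in> {U. openin Y U}" for U
  proof -
    have "f -` U \<inter> topspace X = {x \<in> topspace X. f x \<in> U}"
      by blast
    moreover have "openin X {x \<in> topspace X. f x \<in> U}"
      using openin_continuous_map_preimage[OF assms] that by blast
    ultimately show ?thesis
      by (simp add: openin_imp_sets_borel_of)
  qed
qed (use assms in \<open>auto dest: openin_subset simp: continuous_map_def\<close>)

lemma closed_arc_borel:
  assumes \<phi>: "homeomorphic_map euclideanreal L \<phi>"
    and "x \<in> topspace L" "y \<in> topspace L"
  shows "closed_arc L x y \<in> sets (borel_of L)" "closed_arc L x y \<subseteq> topspace L"
proof -
  obtain a b where ab: "x = \<phi> a" "y = \<phi> b"
    using assms homeomorphic_imp_surjective_map[OF \<phi>] by force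
  have "closedin L (\<phi> ` closed_segment a b)"
    using homeomorphic_map_closedness[OF \<phi>, of "closed_segment a b"] by simp
  then show "closed_arc L x y \<in> sets (borel_of L)" "closed_arc L x y \<subseteq> topspace L"
    unfolding ab closed_arc_parametrization[OF \<phi>]
    by (rule closedin_imp_sets_borel_of, rule closedin_subset)
qed

section \<open>Contraction of arcs under the inverse map\<close>

lemma streamline_subset:
  assumes "measured_turbulation X \<mu> T" "(L, \<nu>) \<in> T"
  shows "topspace L \<subseteq> topspace X"
proof -
  obtain \<phi> where "homeomorphic_map euclideanreal L \<phi>" "continuous_map euclideanreal X \<phi>"
    using assms by (auto simp: measured_turbulation_def immersed_line_def)
  then show ?thesis
    using homeomorphic_imp_surjective_map continuous_map_image_subset_topspace by metis
qed

text \<open>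
  The pairs of the scaled turbulation are all images of pairs of \<open>T\<close>, which is how a streamline and
  its measure are pulled back: if \<open>F\<^sub>* \<nu>\<^sub>0 = c \<nu>\<close>, then the preimage of an arc of \<open>\<nu>\<close>-measure \<open>m\<close>
  is an arc of \<open>\<nu>\<^sub>0\<close>-measure \<open>c m\<close>.
\<close>

lemma pull_back_arc:
  assumes T: "measured_turbulation X \<mu> T" and F: "inj_on F (topspace X)"
    and scale: "image_turbulation F T = scale_turbulation c T"
    and L: "(L, \<nu>) \<in> T" "x \<in> topspace L" "y \<in> topspace L"
  shows "\<exists>(L0, \<nu>0)\<in>T. \<exists>x0\<in>topspace L0. \<exists>y0\<in>topspace L0. F x0 = x \<and> F y0 = y \<and>
           emeasure \<nu>0 (closed_arc L0 x0 y0) = ennreal c * emeasure \<nu> (closed_arc L x y)"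
proof -
  have "(L, scale_measure (ennreal c) \<nu>) \<in> image_turbulation F T"
    using L by (force simp: scale scale_turbulation_def)
  then obtain L0 \<nu>0 where L0: "(L0, \<nu>0) \<in> T" "L = image_line F L0"
    and distr: "scale_measure (ennreal c) \<nu> = distr \<nu>0 (borel_of L) F"
    by (auto simp: image_turbulation_def)
  have inj: "inj_on F (topspace L0)"
    using F streamline_subset[OF T L0(1)] by (rule inj_on_subset)
  have hom: "homeomorphic_map L0 L F"
    using homeomorphic_map_image_line[OF inj] L0 by simp
  obtain \<phi> where \<phi>: "homeomorphic_map euclideanreal L0 \<phi>"
    and \<nu>0: "space \<nu>0 = topspace L0" "sets \<nu>0 = sets (borel_of L0)"
    using T L0(1) by (auto simp: measured_turbulation_def immersed_line_def OU_measure_def)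
  obtain x0 y0 where xy0: "x0 \<in> topspace L0" "y0 \<in> topspace L0" "F x0 = x" "F y0 = y"
    using L homeomorphic_imp_surjective_map[OF hom] by (metis imageE)
  have arc: "closed_arc L x y = F ` closed_arc L0 x0 y0"
    using closed_arc_homeomorphic_image[OF \<phi> hom xy0(1,2)] xy0 by simp
  have meas: "F \<in> measurable \<nu>0 (borel_of L)"
    using continuous_map_imp_measurable_borel_of[OF homeomorphic_imp_continuous_map[OF hom]]
      measurable_cong_sets[OF \<nu>0(2) refl] by blast
  have borel: "closed_arc L x y \<in> sets (borel_of L)"
    using closed_arc_borel(1)[OF homeomorphic_map_compose[OF \<phi> hom] L(2,3)] .
  have "F -` closed_arc L x y \<inter> space \<nu>0 = closed_arc L0 x0 y0"
    using closed_arc_borel(2)[OF \<phi> xy0(1,2)] inj unfolding arc \<nu>0(1) by (auto simp: inj_on_def)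
  then have "emeasure \<nu>0 (closed_arc L0 x0 y0) = emeasure (scale_measure (ennreal c) \<nu>) (closed_arc L x y)"
    using emeasure_distr[OF meas borel] by (simp add: distr)
  then show ?thesis
    using L0(1) xy0 by auto
qed

lemma pull_back_arc_funpow:
  assumes T: "measured_turbulation X \<mu> T" and F: "inj_on F (topspace X)"
    and scale: "image_turbulation F T = scale_turbulation c T"
    and L: "(L, \<nu>) \<in> T" "x \<in> topspace L" "y \<in> topspace L"
  shows "\<exists>(L0, \<nu>0)\<in>T. \<exists>x0\<in>topspace L0. \<exists>y0\<in>topspace L0. (F ^^ n) x0 = x \<and> (F ^^ n) y0 = y \<and>
           emeasure \<nu>0 (closed_arc L0 x0 y0) = ennreal c ^ n * emeasure \<nu> (closed_arc L x y)"
proof (induction n)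
  case 0
  then show ?case
    using L by auto
next
  case (Suc n)
  then obtain L1 \<nu>1 x1 y1 where 1: "(L1, \<nu>1) \<in> T" "x1 \<in> topspace L1" "y1 \<in> topspace L1"
    "(F ^^ n) x1 = x" "(F ^^ n) y1 = y"
    "emeasure \<nu>1 (closed_arc L1 x1 y1) = ennreal c ^ n * emeasure \<nu> (closed_arc L x y)"
    by auto
  obtain L0 \<nu>0 x0 y0 where 0: "(L0, \<nu>0) \<in> T" "x0 \<in> topspace L0" "y0 \<in> topspace L0"
    "F x0 = x1" "F y0 = y1"
    "emeasure \<nu>0 (closed_arc L0 x0 y0) = ennreal c * emeasure \<nu>1 (closed_arc L1 x1 y1)"
    using pull_back_arc[OF T F scale 1(1-3)] by auto
  have "(F ^^ Suc n) x0 = x" "(F ^^ Suc n) y0 = y"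
    using 0 1 by (simp_all add: funpow_Suc_right del: funpow.simps)
  moreover have "emeasure \<nu>0 (closed_arc L0 x0 y0) = ennreal c ^ Suc n * emeasure \<nu> (closed_arc L x y)"
    using 0 1 by (simp add: mult.assoc)
  ultimately show ?case
    using 0(1-3) by blast
qed

section \<open>Recurrence\<close>

lemma homeomorphic_map_funpow:
  assumes "homeomorphic_map X X F"
  shows "homeomorphic_map X X (F ^^ n)"
proof (induction n)
  case 0
  show ?case
    by (simp only: funpow.simps homeomorphic_map_id)
next
  case (Suc n)
  then show ?case
    using homeomorphic_map_compose assms unfolding funpow.simps by blast
qed

text \<open>
  The set \<open>E N\<close> of points that visit \<open>A\<close> under some \<open>F\<^sup>-\<^sup>n\<close> with \<open>n \<ge> N\<close> decreases with \<open>N\<close>, and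
  \<open>F\<close> maps \<open>E N\<close> onto \<open>E (N + 1)\<close>. By invariance all these sets have the same finite measure, so they
  agree up to null sets with \<open>E 0\<close>, which contains \<open>A\<close>.
\<close>

lemma recurrence_open:
  assumes "finite_measure \<mu>" and sets: "sets \<mu> = sets (borel_of X)"
    and F: "homeomorphic_map X X F" and inv: "distr \<mu> \<mu> F = \<mu>" and A: "openin X A"
  shows "AE x in \<mu>. x \<in> A \<longrightarrow> (\<forall>N. \<exists>n\<ge>N. x \<in> (F ^^ n) ` A)"
proof -
  interpret finite_measure \<mu> by fact
  define E where "E N = (\<Union>n\<in>{N..}. (F ^^ n) ` A)" for N
  have space: "space \<mu> = topspace X"
    using sets_eq_imp_space_eq[OF sets] by simp
  have openE: "openin X (E N)" for N
    unfolding E_def using homeomorphic_map_openness[OF homeomorphic_map_funpow[OF F]] A openin_subset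
    by blast
  then have E [measurable]: "E N \<in> sets \<mu>" for N
    by (simp add: sets openin_imp_sets_borel_of)
  have meas: "F \<in> measurable \<mu> \<mu>"
    using continuous_map_imp_measurable_borel_of[OF homeomorphic_imp_continuous_map[OF F]]
      measurable_cong_sets[OF sets sets] by blast
  have step: "E (Suc N) = F ` E N" for N
  proof -
    have "{Suc N..} = Suc ` {N..}"
      by (auto simp: image_iff Suc_le_eq less_iff_Suc_add)
    then show ?thesis
      by (simp add: E_def image_UN image_comp)
  qed
  have "emeasure \<mu> (E (Suc N)) = emeasure \<mu> (E N)" for N
  proof -
    have "F -` E (Suc N) \<inter> space \<mu> = E N"
      using homeomorphic_imp_injective_map[OF F] openin_subset[OF openE[of N]]
      unfolding step space by (auto simp: inj_on_def)
    then show ?thesis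
      using emeasure_distr[OF meas E[of "Suc N"]] by (simp add: inv)
  qed
  then have same: "emeasure \<mu> (E N) = emeasure \<mu> (E 0)" for N
    by (induction N) auto
  have "AE x in \<mu>. x \<notin> E 0 - E N" for N
  proof (rule AE_not_in)
    have "E N \<subseteq> E 0"
      by (auto simp: E_def)
    then show "E 0 - E N \<in> null_sets \<mu>"
      by (intro null_setsI) (simp_all add: emeasure_Diff same[of N])
  qed
  then have "AE x in \<mu>. \<forall>N. x \<notin> E 0 - E N"
    unfolding AE_all_countable by blast
  then show ?thesis
  proof (rule AE_mp, intro AE_I2 impI allI)
    fix x N assume "\<forall>N. x \<notin> E 0 - E N" and "x \<in> A"
    moreover have "(F ^^ 0) ` A \<subseteq> E 0"
      unfolding E_def by blast
    ultimately have "x \<in> E N"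
      by auto
    then show "\<exists>n\<ge>N. x \<in> (F ^^ n) ` A"
      by (auto simp: E_def)
  qed
qed

section \<open>Transitivity\<close>

text \<open>
  The hypothesis \<open>c < 1\<close> says that \<open>F\<^sup>-\<^sup>1\<close> contracts arcs, since a push-forward by \<open>F\<close> of a stream
  measure assigns to an arc the measure of its preimage. Density of the streamlines carries a point
  of \<open>U\<close> to one of \<open>V\<close> along a streamline, and recurrence brings the whole connecting arc, shrunk by
  contraction, back into \<open>U\<close>.
\<close>

lemma transitive_of_contracted_turbulation:
  assumes fin: "finite_measure \<mu>" and OU: "OU_measure X \<mu>"
    and F: "homeomorphic_map X X F" and inv: "distr \<mu> \<mu> F = \<mu>"
    and T: "measured_turbulation X \<mu> T" "tame X T" "dense_streamlines X T"
    and c: "0 < c" "c < 1" and scale: "image_turbulation F T = scale_turbulation c T"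
    and U: "openin X U" "U \<noteq> {}" and V: "openin X V" "V \<noteq> {}"
  shows "\<exists>n>0. (F ^^ n) ` U \<inter> V \<noteq> {}"
proof -
  interpret finite_measure \<mu> by fact
  have sets: "sets \<mu> = sets (borel_of X)" and space: "space \<mu> = topspace X"
    using OU by (auto simp: OU_measure_def)
  obtain d where d: "Metric_space (topspace X) d" "Metric_space.mtopology (topspace X) d = X"
    and tame: "\<forall>\<epsilon>>0. \<exists>\<delta>>0. \<forall>(L, \<nu>)\<in>T. \<forall>x\<in>topspace L. \<forall>y\<in>topspace L.
           x \<noteq> y \<and> emeasure \<nu> (closed_arc L x y) < ennreal \<delta> \<longrightarrow> d x y < \<epsilon>"
    using T(2) unfolding tame_def by (elim exE conjE) (rule that)
  interpret Metric_space "topspace X" d by fact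
  obtain p where p: "p \<in> U"
    using U by blast
  obtain r where r: "r > 0" "mball p r \<subseteq> U"
    using U(1) p openin_mtopology d(2) by metis
  define A where "A = mball p (r / 2)"
  have "p \<in> topspace X"
    using p U openin_subset by blast
  then have "p \<in> A" and openA: "openin X A"
    using r openin_mball[of p "r / 2"] by (auto simp: A_def d)
  then have "emeasure \<mu> A > 0"
    using OU by (auto simp: OU_measure_def)
  define S where "S = (\<Union>(L, \<nu>)\<in>T. topspace L)"
  have S: "S \<in> sets \<mu>" "emeasure \<mu> S = emeasure \<mu> (space \<mu>)"
    using T(1) by (auto simp: measured_turbulation_def space S_def)
  then have "space \<mu> - S \<in> null_sets \<mu>"
    by (intro null_setsI) (simp_all add: emeasure_compl)
  then have full: "AE x in \<mu>. x \<in> S"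
    by (rule AE_I') blast
  have "\<exists>x\<in>A. x \<in> S \<and> (\<forall>N. \<exists>n\<ge>N. x \<in> (F ^^ n) ` A)"
  proof (rule ccontr)
    assume none: "\<not> ?thesis"
    have "AE x in \<mu>. x \<notin> A"
      using full recurrence_open[OF fin sets F inv openA]
      by eventually_elim (use none in blast)
    then show False
      using \<open>emeasure \<mu> A > 0\<close> openin_imp_sets_borel_of[OF openA] sets
        AE_iff_null_sets[of A \<mu>] by auto
  qed
  then obtain x L \<nu> where x: "x \<in> A" "(L, \<nu>) \<in> T" "x \<in> topspace L"
    and rec: "\<And>N. \<exists>n\<ge>N. x \<in> (F ^^ n) ` A"
    unfolding S_def by blast
  have "X closure_of (topspace L) = topspace X"
    using T(3) x(2) by (auto simp: dense_streamlines_def)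
  then obtain y where y: "y \<in> V" "y \<in> topspace L"
    using V openin_subset[OF V(1)] dense_intersects_open by blast
  have fin_arc: "x = y \<or> emeasure \<nu> (closed_arc L x y) < \<infinity>"
    using bspec[OF conjunct1[OF T(1)[unfolded measured_turbulation_def]] x(2)] x(3) y(2) by auto
  obtain \<delta> where \<delta>: "\<delta> > 0" and "\<forall>(L, \<nu>)\<in>T. \<forall>x\<in>topspace L. \<forall>y\<in>topspace L.
      x \<noteq> y \<and> emeasure \<nu> (closed_arc L x y) < ennreal \<delta> \<longrightarrow> d x y < r / 2"
    using tame[rule_format, OF half_gt_zero[OF r(1)]] by (elim exE conjE) (rule that)
  then have small: "\<And>L \<nu> x y. (L, \<nu>) \<in> T \<Longrightarrow> x \<in> topspace L \<Longrightarrow>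
      y \<in> topspace L \<Longrightarrow> x \<noteq> y \<Longrightarrow> emeasure \<nu> (closed_arc L x y) < ennreal \<delta> \<Longrightarrow> d x y < r / 2"
    by blast
  have "\<exists>N. \<forall>n\<ge>N. x \<noteq> y \<longrightarrow> ennreal c ^ n * emeasure \<nu> (closed_arc L x y) < ennreal \<delta>"
  proof (cases "x = y")
    case False
    then obtain m where m: "m \<ge> 0" "emeasure \<nu> (closed_arc L x y) = ennreal m"
      using fin_arc by (cases "emeasure \<nu> (closed_arc L x y)") auto
    have "(\<lambda>n. c ^ n * m) \<longlonglongrightarrow> 0"
      using c by (intro tendsto_mult_left_zero LIMSEQ_realpow_zero) auto
    then have "\<forall>\<^sub>F n in sequentially. c ^ n * m < \<delta>"
      using \<delta> by (rule order_tendstoD(2))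
    then have "\<exists>N. \<forall>n\<ge>N. c ^ n * m < \<delta>"
      by (simp only: eventually_sequentially)
    then show ?thesis
      using c m by (auto simp: ennreal_power ennreal_less_iff simp flip: ennreal_mult)
  qed auto
  then obtain N where N: "\<And>n. n \<ge> N \<Longrightarrow> x \<noteq> y \<Longrightarrow>
      ennreal c ^ n * emeasure \<nu> (closed_arc L x y) < ennreal \<delta>"
    by blast
  obtain n a where n: "n \<ge> Suc N" and a: "a \<in> A" "(F ^^ n) a = x"
    using rec[of "Suc N"] by blast
  have inj: "inj_on F (topspace X)"
    using F homeomorphic_imp_injective_map by blast
  obtain L0 \<nu>0 x0 y0 where 0: "(L0, \<nu>0) \<in> T" "x0 \<in> topspace L0" "y0 \<in> topspace L0"
    "(F ^^ n) x0 = x" "(F ^^ n) y0 = y"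
    "emeasure \<nu>0 (closed_arc L0 x0 y0) = ennreal c ^ n * emeasure \<nu> (closed_arc L x y)"
    using pull_back_arc_funpow[OF T(1) inj scale x(2,3) y(2)] by blast
  have X0: "x0 \<in> topspace X" "y0 \<in> topspace X"
    using 0 streamline_subset[OF T(1)] by blast+
  have "x0 = a"
    using homeomorphic_imp_injective_map[OF homeomorphic_map_funpow[OF F, of n]] X0(1) a 0(4)
      openin_subset[OF openA] by (auto simp: inj_on_def)
  have "d x0 y0 < r / 2"
  proof (cases "x0 = y0")
    case True
    then show ?thesis
      using r X0 by simp
  next
    case False
    then have "x \<noteq> y"
      using homeomorphic_imp_injective_map[OF homeomorphic_map_funpow[OF F, of n]] X0 0(4,5)
      by (auto simp: inj_on_def)
    then show ?thesis
      using small[OF 0(1-3) False] N[of n] n 0(6) by simp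
  qed
  moreover have "d p x0 < r / 2"
    using a \<open>x0 = a\<close> by (simp add: A_def)
  ultimately have "d p y0 < r"
    using triangle[OF \<open>p \<in> topspace X\<close> X0] by linarith
  then have "y0 \<in> U"
    using r X0 \<open>p \<in> topspace X\<close> by auto
  then show ?thesis
    using y 0(5) n by (intro exI[of _ n]) auto
qed

theorem theorem6p1:
  fixes X :: "'a topology" and \<mu> :: "'a measure" and F :: "'a \<Rightarrow> 'a"
  assumes "compact_surface X"
    and "OU_surface_measure X \<mu>"
    and "prob_space \<mu>"
    and "measurable_pseudo_Anosov X \<mu> F"
  shows "\<forall>U V. openin X U \<and> U \<noteq> {} \<and> openin X V \<and> V \<noteq> {} \<longrightarrow>
           (\<exists>n>0. (F ^^ n) ` U \<inter> V \<noteq> {})"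
proof -
  obtain Ts Tu and k :: real where "k > 1" and T: "mpA_turbulations X \<mu> Ts Tu"
    and scale: "image_turbulation F Tu = scale_turbulation (inverse k) Tu"
    and F: "homeomorphic_map X X F" "distr \<mu> \<mu> F = \<mu>"
    using assms(4) unfolding measurable_pseudo_Anosov_def by blast
  have "0 < inverse k" "inverse k < 1"
    using \<open>k > 1\<close> by (auto simp: inverse_less_1_iff)
  moreover have "finite_measure \<mu>" "OU_measure X \<mu>"
    using assms(2,3) by (auto simp: OU_surface_measure_def prob_space_def)
  ultimately show ?thesis
    using T F scale transitive_of_contracted_turbulation[of \<mu> X F Tu "inverse k"]
    unfolding mpA_turbulations_def by blast
qed

end
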